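(* Let $(\Omega,\mathcal{F}_\infty,\{\mathcal{F}_t\}_{t\in\mathcal{T}})$ be a filtered measurable space, where $\mathcal{T}=[0,\infty)$ or $\mathcal{T}=\{0,1,2,\ldots\}$, and set $\overline{\mathcal{T}}=\mathcal{T}\cup\{\infty\}$. Let $P$ and $\widetilde P$ be probability measures on $(\Omega,\mathcal{F}_\infty)$, let $F:\overline{\mathcal{T}}\times\Omega\to\overline{\mathbb{R}}$, written $F_t(\omega)$, be progressively measurable, and let $\tau:\Omega\to\overline{\mathcal{T}}$ be an $\mathcal{F}_t$-stopping time. Suppose $F_\tau\in L^1(\widetilde P)$. Then, for each of the two choices of sign, $$\pm E_{\widetilde P}[F_\tau]\leq \inf_{c>0}\left\{\frac{1}{c} \Lambda_{P}^{F_\tau}(\pm c)+\frac{1}{c}R((F_\tau)_*\widetilde P\|(F_{\tau})_*P)\right\} \leq\inf_{c>0}\left\{\frac{1}{c} \Lambda_{P}^{F_\tau}(\pm c)+\frac{1}{c}R(\widetilde P|_{\mathcal{F}_\tau}\|P|_{\mathcal{F}_\tau})\right\}.$$ If, in addition, $R(\widetilde P|_{\mathcal{F}_\tau}\|P|_{\mathcal{F}_\tau})\leq E_{\widetilde{P}}[G]$ for some $\mathcal{F}_{\tau}$-measurable real-valued $G\in L^1(\widetilde{P})$, then $$\pm E_{\widetilde{P}}[F_\tau]\leq\inf_{c>0}\left\{\frac{1}{c} \log E_P\left[\exp\left(\pm c F_\tau+G\right)\right]\right\}.$$ The objective functions (functions of $c>0$ inside the infima) in all of these bounds are quasiconvex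.
   Context: $\overline{\mathbb{R}}$ denotes the extended real line. Progressively measurable means that $F$ is measurable and, for every $t\in\mathcal{T}$, $F|_{[0,t]\times\Omega}$ is $\mathcal{B}([0,t])\otimes\mathcal{F}_t$-measurable (intervals are subsets of $\mathcal{T}$). $F_\tau(\omega)=F_{\tau(\omega)}(\omega)$ and $\mathcal{F}_\tau=\{A\in\mathcal{F}_\infty:\ A\cap\{\tau\leq t\}\in\mathcal{F}_t \text{ for all } t\in\mathcal{T}\}$. $\psi_*Q$ denotes the distribution of $\psi$ under $Q$, and $Q|_{\mathcal{G}}$ the restriction of $Q$ to the sub sigma-algebra $\mathcal{G}$. The cumulant generating function is $\Lambda_P^F(c)=\log E_P[e^{cF}]$ (natural logarithm, with the continuous extensions of $\exp$ to $\overline{\mathbb{R}}$ and of $\log$ to $[0,\infty]$). The relative entropy is $R(\widetilde P\|P)=E_{\widetilde P}[\log(d\widetilde P/dP)]$ if $\widetilde P\ll P$, and $+\infty$ otherwise. The sum $-\infty+\infty$ is interpreted as $\infty$. A formula with $\pm$ stands for two formulas, one with all upper signs and one with all lower signs. *)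

theory Defs
  imports "HOL-Probability.Probability" "HOL-Probability.Stopping_Time"
begin

text \<open>
  The time axis including infinity is modelled as a type, so that the library's \<open>filtration\<close>,
  \<open>stopping_time\<close> and \<open>pre_sigma\<close> apply. The class contains exactly the types that are
  order isomorphic (hence homeomorphic, because of the order topology) to \<open>[0, \<infinity>]\<close> or to
  \<open>{0, 1, 2, \<dots>, \<infinity>}\<close>. The element \<open>top\<close> is the time infinity, and the finite times are those
  below \<open>top\<close>. For a filtration \<open>\<F>\<close> over such a type, \<open>\<F> top\<close> is the ambient sigma-algebra. At
  \<open>t = top\<close> the condition in \<open>stopping_time\<close> is vacuous, and the condition in \<open>pre_sigma\<close> reads
  \<open>A \<in> sets (\<F> top)\<close>.
\<close>

class extended_time = linorder_topology + second_countable_topology + order_top +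
  assumes continuous_or_discrete:
    "(\<exists>e :: 'a \<Rightarrow> ennreal. bij e \<and> strict_mono e) \<or> (\<exists>e :: 'a \<Rightarrow> enat. bij e \<and> strict_mono e)"

instance ennreal :: extended_time
  by standard (intro disjI1 exI[of _ "\<lambda>x. x"], auto simp: strict_mono_def bij_def)

instance enat :: extended_time
  by standard (intro disjI2 exI[of _ "\<lambda>x. x"], auto simp: strict_mono_def bij_def)

definition progressively_measurable ::
  "('t::extended_time \<Rightarrow> 'a measure) \<Rightarrow> ('t \<Rightarrow> 'a \<Rightarrow> ereal) \<Rightarrow> bool" where
  "progressively_measurable \<F> F \<longleftrightarrow>
     (\<lambda>(t, \<omega>). F t \<omega>) \<in> borel_measurable (borel \<Otimes>\<^sub>M \<F> top) \<and>
     (\<forall>t<top. (\<lambda>(s, \<omega>). F s \<omega>) \<in> borel_measurable (restrict_space borel {..t} \<Otimes>\<^sub>M \<F> t))"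

definition stopped_value :: "('t \<Rightarrow> 'a \<Rightarrow> 'b) \<Rightarrow> ('a \<Rightarrow> 't) \<Rightarrow> 'a \<Rightarrow> 'b" where
  "stopped_value F \<tau> \<omega> = F (\<tau> \<omega>) \<omega>"

text \<open>
  \<open>e2ennreal\<close> sends negative arguments to \<open>0\<close>, so the two integrals below are those of the
  positive and the negative part. Addition on \<open>ereal\<close> satisfies \<open>\<infinity> + (- \<infinity>) = \<infinity>\<close>.
\<close>

definition ereal_integral :: "'a measure \<Rightarrow> ('a \<Rightarrow> ereal) \<Rightarrow> ereal" where
  "ereal_integral M f =
     enn2ereal (\<integral>\<^sup>+ x. e2ennreal (f x) \<partial>M) - enn2ereal (\<integral>\<^sup>+ x. e2ennreal (- f x) \<partial>M)"

definition ereal_integrable :: "'a measure \<Rightarrow> ('a \<Rightarrow> ereal) \<Rightarrow> bool" where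
  "ereal_integrable M f \<longleftrightarrow> f \<in> borel_measurable M \<and> (\<integral>\<^sup>+ x. e2ennreal \<bar>f x\<bar> \<partial>M) < \<infinity>"

definition exp_ereal :: "ereal \<Rightarrow> ennreal" where
  "exp_ereal x = (case x of ereal r \<Rightarrow> ennreal (exp r) | PInfty \<Rightarrow> \<infinity> | MInfty \<Rightarrow> 0)"

definition ln_ennreal :: "ennreal \<Rightarrow> ereal" where
  "ln_ennreal x = (if x = 0 then - \<infinity> else if x = \<infinity> then \<infinity> else ereal (ln (enn2real x)))"

definition cumulant_gen :: "'a measure \<Rightarrow> ('a \<Rightarrow> ereal) \<Rightarrow> real \<Rightarrow> ereal" where
  "cumulant_gen P Y c = ln_ennreal (\<integral>\<^sup>+ \<omega>. exp_ereal (ereal c * Y \<omega>) \<partial>P)"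

text \<open>
  The library's \<open>KL_divergence\<close> is real valued, and it is \<open>0\<close> when the log-density is not integrable;
  its first argument is the reference measure. Here the reference measure is the second argument.
\<close>

definition relative_entropy :: "'a measure \<Rightarrow> 'a measure \<Rightarrow> ereal" where
  "relative_entropy Q P =
     (if absolutely_continuous P Q
      then ereal_integral Q (\<lambda>x. ln_ennreal (RN_deriv P Q x)) else \<infinity>)"

definition quasiconvex_on :: "'a::real_vector set \<Rightarrow> ('a \<Rightarrow> ereal) \<Rightarrow> bool" where
  "quasiconvex_on S f \<longleftrightarrow> convex S \<and>
     (\<forall>x\<in>S. \<forall>y\<in>S. \<forall>u\<ge>0. \<forall>v\<ge>0. u + v = 1 \<longrightarrow> f (u *\<^sub>R x + v *\<^sub>R y) \<le> max (f x) (f y))"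

end

theory Submission
  imports Defs
begin

text \<open>
  Everything about entropy rests on one inequality, \<open>integral_ln_le_relative_entropy\<close>: if
  \<open>Q\<close> has density \<open>h\<close> with respect to \<open>P\<close> and \<open>\<phi> \<ge> 0\<close> has \<open>P\<close>-integral at most \<open>1\<close>, then
  \<open>E\<^sub>Q[log \<phi>] \<le> E\<^sub>Q[log h] = R(Q\<parallel>P)\<close>. The reason is the tangent line \<open>log x \<le> x - 1\<close> at \<open>x = \<phi> / h\<close>:
  it gives \<open>log \<phi> \<le> log h + \<phi> / h - 1\<close>, and \<open>E\<^sub>Q[\<phi> / h] = E\<^sub>P[\<phi>; h > 0] \<le> 1\<close>. Three choices of \<open>\<phi>\<close>
  give the facts needed below.

  \<^item> \<open>\<phi> = 1\<close>: relative entropy is nonnegative.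
  \<^item> \<open>\<phi> = exp f / E\<^sub>P[exp f]\<close>: the Gibbs (Donsker-Varadhan) inequality
    \<open>E\<^sub>Q[f] \<le> log E\<^sub>P[exp f] + R(Q\<parallel>P)\<close>.
  \<^item> \<open>\<phi> = k \<circ> X\<close>, where \<open>k\<close> is the density between the images of \<open>Q\<close> and \<open>P\<close> under \<open>X\<close>: the data
    processing inequality, that mapping both measures by \<open>X\<close> does not increase relative entropy.

  In the theorem, \<open>P'\<close> takes the place of \<open>Q\<close>.
  The first bound is the Gibbs inequality for the laws of \<open>F\<^sub>\<tau>\<close> and the function \<open>y \<mapsto> \<plusminus>c y\<close>,
  divided by \<open>c\<close>. The second one is data processing for the map \<open>F\<^sub>\<tau>\<close>, which is measurable with
  respect to the sigma-algebra at time \<open>\<tau>\<close> because \<open>F\<close> is progressively measurable. The bound with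
  \<open>G\<close> is the Gibbs inequality on that sigma-algebra for \<open>\<plusminus>c F\<^sub>\<tau> + G\<close>: the relative entropy on
  the right is absorbed by \<open>E\<^sub>Q[G]\<close> on the left.

  All objective functions have the form \<open>c \<mapsto> (log E\<^sub>P[exp (\<plusminus>c Y + G)] + R) / c\<close>. Such a function is
  at most \<open>a\<close> at \<open>c\<close> if and only if \<open>E\<^sub>P[exp (\<plusminus>c Y + G + R - a c)] \<le> 1\<close>. The exponent is affine in
  \<open>c\<close>, so convexity of \<open>exp\<close> makes the set of these \<open>c\<close> convex, which is quasiconvexity.
\<close>

section \<open>Extended exponentials, logarithms and integrals\<close>

lemma measurable_exp_ereal [measurable]: "exp_ereal \<in> borel_measurable borel"
proof -
  have "exp_ereal = (\<lambda>x. if x = \<infinity> then \<infinity> else if x = - \<infinity> then 0 else ennreal (exp (real_of_ereal x)))"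
    by (rule ext) (auto simp: exp_ereal_def split: ereal.splits)
  also have "\<dots> \<in> borel_measurable borel"
    by measurable
  finally show ?thesis .
qed

lemma measurable_ln_ennreal [measurable]: "ln_ennreal \<in> borel_measurable borel"
  unfolding ln_ennreal_def[abs_def] by measurable

lemma exp_ereal_simps [simp]:
  "exp_ereal (ereal r) = ennreal (exp r)" "exp_ereal \<infinity> = \<infinity>" "exp_ereal (- \<infinity>) = 0"
  by (simp_all add: exp_ereal_def)

lemma ln_ennreal_ennreal: "0 < r \<Longrightarrow> ln_ennreal (ennreal r) = ereal (ln r)"
  by (simp add: ln_ennreal_def)

lemma ln_ennreal_simps [simp]:
  "ln_ennreal 0 = - \<infinity>" "ln_ennreal \<infinity> = \<infinity>" "ln_ennreal top = \<infinity>" "ln_ennreal 1 = 0"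
  by (simp_all add: ln_ennreal_def)

lemma ereal_integral_mono_AE:
  assumes "AE x in M. f x \<le> g x"
  shows "ereal_integral M f \<le> ereal_integral M g"
  unfolding ereal_integral_def
proof (rule ereal_minus_mono)
  show "enn2ereal (\<integral>\<^sup>+ x. e2ennreal (f x) \<partial>M) \<le> enn2ereal (\<integral>\<^sup>+ x. e2ennreal (g x) \<partial>M)"
    using assms by (auto intro!: nn_integral_mono_AE e2ennreal_mono simp flip: less_eq_ennreal.rep_eq)
  show "enn2ereal (\<integral>\<^sup>+ x. e2ennreal (- g x) \<partial>M) \<le> enn2ereal (\<integral>\<^sup>+ x. e2ennreal (- f x) \<partial>M)"
    using assms by (auto intro!: nn_integral_mono_AE e2ennreal_mono simp flip: less_eq_ennreal.rep_eq)
qed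

lemma ereal_integral_eq_integral:
  assumes g: "integrable M g" and eq: "AE x in M. f x = ereal (g x)"
  shows "ereal_integral M f = ereal (\<integral>x. g x \<partial>M)"
proof -
  have pos: "(\<integral>\<^sup>+ x. e2ennreal (f x) \<partial>M) = (\<integral>\<^sup>+ x. ennreal (g x) \<partial>M)"
    using eq by (intro nn_integral_cong_AE) auto
  have neg: "(\<integral>\<^sup>+ x. e2ennreal (- f x) \<partial>M) = (\<integral>\<^sup>+ x. ennreal (- g x) \<partial>M)"
    using eq by (intro nn_integral_cong_AE) auto
  have fin: "(\<integral>\<^sup>+ x. ennreal (g x) \<partial>M) \<noteq> \<infinity>" "(\<integral>\<^sup>+ x. ennreal (- g x) \<partial>M) \<noteq> \<infinity>"
    using g by (auto simp: real_integrable_def)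
  show ?thesis
    using fin unfolding ereal_integral_def pos neg real_lebesgue_integral_def[OF g]
    by (cases "\<integral>\<^sup>+ x. ennreal (g x) \<partial>M"; cases "\<integral>\<^sup>+ x. ennreal (- g x) \<partial>M") auto
qed

text \<open>
  The finiteness of the integral forces \<open>f\<close> to be finite almost everywhere. This reduces integrable
  extended real functions to real ones, for which the integral is linear.
\<close>

lemma ereal_integrable_iff_real:
  "ereal_integrable M f \<longleftrightarrow> f \<in> borel_measurable M \<and>
     (\<exists>g. integrable M g \<and> (AE x in M. f x = ereal (g x)))"
proof (intro iffI conjI)
  assume f: "ereal_integrable M f"
  then show [measurable]: "f \<in> borel_measurable M"
    by (simp add: ereal_integrable_def)
  have fin: "(\<integral>\<^sup>+ x. e2ennreal \<bar>f x\<bar> \<partial>M) < \<infinity>"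
    using f by (simp add: ereal_integrable_def)
  then have "AE x in M. e2ennreal \<bar>f x\<bar> \<noteq> \<infinity>"
    by (intro nn_integral_noteq_infinite) auto
  then have AE: "AE x in M. f x = ereal (real_of_ereal (f x))"
  proof eventually_elim
    case (elim x)
    then show ?case by (cases "f x") auto
  qed
  have "(\<integral>\<^sup>+ x. ennreal (norm (real_of_ereal (f x))) \<partial>M) = (\<integral>\<^sup>+ x. e2ennreal \<bar>f x\<bar> \<partial>M)"
    using AE
  proof (intro nn_integral_cong_AE, eventually_elim)
    case (elim x)
    then show ?case by (cases "f x") auto
  qed
  then have "integrable M (\<lambda>x. real_of_ereal (f x))"
    using fin by (intro integrableI_bounded) auto
  with AE show "\<exists>g. integrable M g \<and> (AE x in M. f x = ereal (g x))"
    by blast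
next
  assume *: "f \<in> borel_measurable M \<and> (\<exists>g. integrable M g \<and> (AE x in M. f x = ereal (g x)))"
  then obtain g where g: "integrable M g" "AE x in M. f x = ereal (g x)"
    by blast
  have "(\<integral>\<^sup>+ x. e2ennreal \<bar>f x\<bar> \<partial>M) = (\<integral>\<^sup>+ x. ennreal (norm (g x)) \<partial>M)"
    using g(2) by (intro nn_integral_cong_AE) auto
  also have "\<dots> < \<infinity>"
    using g(1) by (simp add: integrable_iff_bounded)
  finally show "ereal_integrable M f"
    using * by (simp add: ereal_integrable_def)
qed

section \<open>An upper bound for logarithmic integrals by relative entropy\<close>

text \<open>
  This is \<open>log x \<le> x - 1\<close> at \<open>x = a / h\<close>, with \<open>log h\<close> moved to the right: then \<open>a = 0\<close> makes
  the left side \<open>-\<infinity>\<close>, and the right side is real.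
\<close>

lemma ln_ennreal_le_tangent:
  assumes "a \<noteq> \<infinity>" "h \<noteq> 0" "h \<noteq> \<infinity>"
  shows "ln_ennreal a \<le> ereal (ln (enn2real h) + enn2real (a / h) - 1)"
proof (cases "a = 0")
  case False
  then obtain r s where rs: "a = ennreal r" "h = ennreal s" "0 < r" "0 < s"
    using assms by (cases a; cases h) (auto simp: less_le)
  then have "ln (r / s) \<le> r / s - 1"
    by (intro ln_le_minus_one) simp
  then show ?thesis
    using rs by (simp add: ln_ennreal_ennreal divide_ennreal ln_div)
qed simp

text \<open>
  If the positive part of \<open>log h\<close> has infinite integral, then the relative entropy is infinite,
  whatever the negative part. Otherwise \<open>log h\<close> is integrable, because \<open>\<phi> = 1\<close> in the tangent
  inequality bounds its negative part by \<open>1 / h\<close>, and the inequality for \<open>\<phi>\<close> can be integrated.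
  The integral of \<open>log \<phi>\<close> itself may be \<open>-\<infinity>\<close>.
\<close>

lemma integral_ln_le_relative_entropy:
  assumes "prob_space P" "prob_space Q" and sets: "sets Q = sets P"
    and ac: "absolutely_continuous P Q"
    and \<phi>[measurable]: "\<phi> \<in> borel_measurable P" and le1: "(\<integral>\<^sup>+ x. \<phi> x \<partial>P) \<le> 1"
  shows "ereal_integral Q (\<lambda>x. ln_ennreal (\<phi> x)) \<le> relative_entropy Q P"
proof -
  interpret P: prob_space P by fact
  interpret Q: prob_space Q by fact
  note [measurable_cong] = sets
  define h where "h = RN_deriv P Q"
  have h[measurable]: "h \<in> borel_measurable P"
    by (simp add: h_def)
  have Q: "Q = density P h"
    unfolding h_def using ac sets by (simp add: P.density_RN_deriv)
  have h_fin: "AE x in P. h x \<noteq> \<infinity>"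
    unfolding h_def by (rule P.RN_deriv_finite) (use ac sets Q.sigma_finite_measure_axioms in auto)
  have h_AE: "AE x in Q. h x \<noteq> 0 \<and> h x \<noteq> \<infinity>"
    using h_fin unfolding Q by (subst AE_density) auto
  have ratio: "integrable Q (\<lambda>x. enn2real (\<psi> x / h x)) \<and> (\<integral>x. enn2real (\<psi> x / h x) \<partial>Q) \<le> 1"
    if [measurable]: "\<psi> \<in> borel_measurable P" and le: "(\<integral>\<^sup>+ x. \<psi> x \<partial>P) \<le> 1" for \<psi>
  proof -
    have cancel: "b * (a / b) \<le> a" for a b :: ennreal
      by (cases "b = 0 \<or> b = \<infinity>") (auto simp: ennreal_mult_divide_eq ennreal_times_divide mult.commute)
    have "(\<integral>\<^sup>+ x. ennreal (enn2real (\<psi> x / h x)) \<partial>Q) \<le> (\<integral>\<^sup>+ x. \<psi> x / h x \<partial>Q)"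
      by (intro nn_integral_mono) (simp add: ennreal_enn2real_if)
    also have "\<dots> = (\<integral>\<^sup>+ x. h x * (\<psi> x / h x) \<partial>P)"
      unfolding Q by (subst nn_integral_density) auto
    also have "\<dots> \<le> (\<integral>\<^sup>+ x. \<psi> x \<partial>P)"
      by (intro nn_integral_mono cancel)
    finally have *: "(\<integral>\<^sup>+ x. ennreal (enn2real (\<psi> x / h x)) \<partial>Q) \<le> 1"
      using le by simp
    then have "integrable Q (\<lambda>x. enn2real (\<psi> x / h x))"
      by (intro integrableI_bounded) (auto simp: le_less_trans[OF _ ennreal_one_less_top])
    moreover have "(\<integral>x. enn2real (\<psi> x / h x) \<partial>Q) \<le> 1"
      using * by (subst integral_eq_nn_integral) (auto intro: enn2real_leI)
    ultimately show ?thesis ..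
  qed
  have R: "relative_entropy Q P = ereal_integral Q (\<lambda>x. ln_ennreal (h x))"
    using ac by (simp add: relative_entropy_def h_def)
  show ?thesis
  proof (cases "(\<integral>\<^sup>+ x. e2ennreal (ln_ennreal (h x)) \<partial>Q) = \<infinity>")
    case True
    then have "relative_entropy Q P = \<infinity>"
      unfolding R ereal_integral_def by simp
    then show ?thesis by simp
  next
    case False
    define l where "l x = ln (enn2real (h x))" for x
    have l: "AE x in Q. ln_ennreal (h x) = ereal (l x)"
      using h_AE by eventually_elim (simp add: l_def ln_ennreal_def)
    have one: "integrable Q (\<lambda>x. enn2real (1 / h x))"
      using ratio[of "\<lambda>_. 1"] P.emeasure_space_1 by simp
    \<comment> \<open>Here \<open>\<bar>l\<bar> \<le> max 0 l + 1 / h\<close>, which follows from the tangent inequality with \<open>a = 1\<close>.\<close>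
    have "(\<integral>\<^sup>+ x. ennreal (norm (l x)) \<partial>Q)
        \<le> (\<integral>\<^sup>+ x. e2ennreal (ln_ennreal (h x)) + ennreal (enn2real (1 / h x)) \<partial>Q)"
    proof (rule nn_integral_mono_AE)
      show "AE x in Q. ennreal (norm (l x))
              \<le> e2ennreal (ln_ennreal (h x)) + ennreal (enn2real (1 / h x))"
        using h_AE l
      proof eventually_elim
        case (elim x)
        have "0 \<le> l x + enn2real (1 / h x) - 1"
          using ln_ennreal_le_tangent[of 1 "h x"] elim by (simp add: l_def)
        then have "norm (l x) \<le> max 0 (l x) + enn2real (1 / h x)"
          by (auto simp: max_def)
        then have "ennreal (norm (l x)) \<le> ennreal (max 0 (l x) + enn2real (1 / h x))"
          by (rule ennreal_leI)
        also have "\<dots> = ennreal (max 0 (l x)) + ennreal (enn2real (1 / h x))"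
          by (rule ennreal_plus) auto
        finally show ?case
          using elim by simp
      qed
    qed
    also have "\<dots> = (\<integral>\<^sup>+ x. e2ennreal (ln_ennreal (h x)) \<partial>Q) + (\<integral>\<^sup>+ x. ennreal (enn2real (1 / h x)) \<partial>Q)"
      by (rule nn_integral_add) auto
    also have "\<dots> < \<infinity>"
      using False one by (auto simp: integrable_iff_bounded less_top)
    finally have l_int: "integrable Q l"
      by (intro integrableI_bounded) (auto simp: l_def[abs_def])
    define u where "u x = enn2real (\<phi> x / h x)" for x
    have u: "integrable Q u" "(\<integral>x. u x \<partial>Q) \<le> 1"
      using ratio[OF \<phi> le1] by (simp_all add: u_def[abs_def])
    have "AE x in P. \<phi> x \<noteq> \<infinity>"
      using le1 by (intro nn_integral_noteq_infinite) (auto simp: top_unique)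
    then have \<phi>_fin: "AE x in Q. \<phi> x \<noteq> \<infinity>"
      using absolutely_continuous_AE[OF sets ac] by blast
    have "ereal_integral Q (\<lambda>x. ln_ennreal (\<phi> x)) \<le> ereal_integral Q (\<lambda>x. ereal (l x + u x - 1))"
    proof (rule ereal_integral_mono_AE)
      show "AE x in Q. ln_ennreal (\<phi> x) \<le> ereal (l x + u x - 1)"
        using h_AE \<phi>_fin by eventually_elim (simp add: l_def u_def ln_ennreal_le_tangent)
    qed
    also have "\<dots> = ereal (\<integral>x. l x + u x - 1 \<partial>Q)"
      using l_int u by (intro ereal_integral_eq_integral) auto
    also have "\<dots> \<le> ereal (\<integral>x. l x \<partial>Q)"
      using l_int u by (simp add: Q.prob_space)
    also have "\<dots> = relative_entropy Q P"
      unfolding R using l_int l by (intro ereal_integral_eq_integral[symmetric])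
    finally show ?thesis .
  qed
qed

lemma relative_entropy_nonneg:
  assumes "prob_space P" "prob_space Q" "sets Q = sets P"
  shows "0 \<le> relative_entropy Q P"
proof (cases "absolutely_continuous P Q")
  case True
  have "(\<integral>\<^sup>+ x. 1 \<partial>P) \<le> 1"
    using prob_space.emeasure_space_1[OF assms(1)] by simp
  then have "ereal_integral Q (\<lambda>x. ln_ennreal 1) \<le> relative_entropy Q P"
    using assms True by (intro integral_ln_le_relative_entropy) auto
  then show ?thesis
    by (simp add: ereal_integral_def e2ennreal_neg)
qed (simp add: relative_entropy_def)

text \<open>
  The argument with \<open>\<phi> = exp f / Z\<close> needs \<open>0 < Z < \<infinity>\<close> for \<open>Z = E\<^sub>P[exp f]\<close>. For \<open>Z = \<infinity>\<close> the right
  side is \<open>\<infinity>\<close>. For \<open>Z = 0\<close> the function \<open>f\<close> is \<open>-\<infinity>\<close> almost everywhere for \<open>P\<close>, hence for \<open>Q\<close> if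
  \<open>Q\<close> is absolutely continuous, which contradicts integrability; and without absolute continuity the
  right side is \<open>\<infinity>\<close>, since \<open>-\<infinity> + \<infinity> = \<infinity>\<close>.
\<close>

lemma gibbs_variational_inequality:
  assumes "prob_space P" "prob_space Q" and sets: "sets Q = sets P"
    and f: "ereal_integrable Q f"
  shows "ereal_integral Q f \<le> ln_ennreal (\<integral>\<^sup>+ x. exp_ereal (f x) \<partial>P) + relative_entropy Q P"
proof (cases "absolutely_continuous P Q")
  case ac: True
  interpret P: prob_space P by fact
  interpret Q: prob_space Q by fact
  have [measurable]: "f \<in> borel_measurable P"
    using f sets by (simp add: ereal_integrable_def cong: measurable_cong_sets)
  obtain g where g: "integrable Q g" "AE x in Q. f x = ereal (g x)"
    using f by (auto simp: ereal_integrable_iff_real)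
  define Z where "Z = (\<integral>\<^sup>+ x. exp_ereal (f x) \<partial>P)"
  have "Z \<noteq> 0"
  proof
    assume "Z = 0"
    then have "AE x in P. exp_ereal (f x) = 0"
      unfolding Z_def by (subst (asm) nn_integral_0_iff_AE) auto
    then have "AE x in Q. exp_ereal (f x) = 0"
      using absolutely_continuous_AE[OF sets ac] by blast
    with g(2) have "AE x in Q. False"
      by eventually_elim simp
    then show False
      by simp
  qed
  show ?thesis
  proof (cases "Z = \<infinity>")
    case True
    then show ?thesis by (simp add: Z_def[symmetric])
  next
    case False
    then obtain z where z: "Z = ennreal z" "0 < z"
      using \<open>Z \<noteq> 0\<close> by (cases Z) (auto simp: less_le)
    have "(\<integral>\<^sup>+ x. exp_ereal (f x) / Z \<partial>P) = Z / Z"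
      unfolding Z_def by (rule nn_integral_divide) simp
    also have "\<dots> = 1"
      using z by (simp add: divide_ennreal)
    finally have "(\<integral>\<^sup>+ x. exp_ereal (f x) / Z \<partial>P) \<le> 1" by simp
    then have "ereal_integral Q (\<lambda>x. ln_ennreal (exp_ereal (f x) / Z)) \<le> relative_entropy Q P"
      using assms ac by (intro integral_ln_le_relative_entropy) auto
    also have "ereal_integral Q (\<lambda>x. ln_ennreal (exp_ereal (f x) / Z)) = ereal (\<integral>x. g x - ln z \<partial>Q)"
    proof (rule ereal_integral_eq_integral)
      show "AE x in Q. ln_ennreal (exp_ereal (f x) / Z) = ereal (g x - ln z)"
        using g(2) by eventually_elim (use z in \<open>simp add: divide_ennreal ln_ennreal_ennreal ln_div\<close>)
    qed (use g in simp)
    also have "\<dots> = ereal (\<integral>x. g x \<partial>Q) - ereal (ln z)"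
      using g by (simp add: Q.prob_space)
    also have "ereal (\<integral>x. g x \<partial>Q) = ereal_integral Q f"
      using g by (intro ereal_integral_eq_integral[symmetric])
    finally show ?thesis
      unfolding Z_def[symmetric] z(1) using z(2)
      by (simp add: ln_ennreal_ennreal ereal_minus_le_iff add.commute)
  qed
qed (simp add: relative_entropy_def)

text \<open>
  Data processing. With \<open>k\<close> the density of the image of \<open>Q\<close> with respect to the image of \<open>P\<close>, the
  function \<open>k \<circ> X\<close> has \<open>P\<close>-integral \<open>1\<close>, and its logarithm has as \<open>Q\<close>-integral the relative entropy
  of the images.
\<close>

lemma relative_entropy_distr_le:
  assumes "prob_space P" "prob_space Q" and sets: "sets Q = sets P"
    and X[measurable]: "X \<in> measurable P N"
  shows "relative_entropy (distr Q N X) (distr P N X) \<le> relative_entropy Q P"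
proof (cases "absolutely_continuous P Q")
  case ac: True
  interpret P: prob_space P by fact
  interpret Q: prob_space Q by fact
  note [measurable_cong] = sets
  let ?P = "distr P N X" and ?Q = "distr Q N X"
  have space: "space Q = space P"
    using sets by (rule sets_eq_imp_space_eq)
  have ac': "absolutely_continuous ?P ?Q"
    unfolding absolutely_continuous_def
  proof
    fix A assume "A \<in> null_sets ?P"
    then have A[measurable]: "A \<in> sets N" and 0: "emeasure P (X -` A \<inter> space P) = 0"
      by (auto simp: null_sets_def emeasure_distr)
    then have "X -` A \<inter> space P \<in> null_sets P"
      by auto
    then have "X -` A \<inter> space P \<in> null_sets Q"
      using ac by (auto simp: absolutely_continuous_def)
    then show "A \<in> null_sets ?Q"
      using A by (auto simp: null_sets_def emeasure_distr space)
  qed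
  interpret P': prob_space ?P by (rule P.prob_space_distr) fact
  interpret Q': prob_space ?Q by (rule Q.prob_space_distr) measurable
  define k where "k = RN_deriv ?P ?Q"
  have k[measurable]: "k \<in> borel_measurable N"
    using borel_measurable_RN_deriv[of ?P ?Q] by (simp add: k_def)
  have "relative_entropy ?Q ?P = ereal_integral Q (\<lambda>x. ln_ennreal (k (X x)))"
    using ac' unfolding relative_entropy_def ereal_integral_def k_def[symmetric]
    by (simp add: nn_integral_distr)
  also have "\<dots> \<le> relative_entropy Q P"
  proof (rule integral_ln_le_relative_entropy)
    have "(\<integral>\<^sup>+ x. k (X x) \<partial>P) = emeasure (density ?P k) (space ?P)"
      using measurable_space[OF X]
      by (auto simp: emeasure_density nn_integral_distr indicator_def intro!: nn_integral_cong)
    also have "density ?P k = ?Q"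
      unfolding k_def using ac' by (intro P'.density_RN_deriv) auto
    finally show "(\<integral>\<^sup>+ x. k (X x) \<partial>P) \<le> 1"
      using Q'.emeasure_space_1 by simp
  qed (use assms ac in auto)
  finally show ?thesis .
qed (simp add: relative_entropy_def)

section \<open>The stopped process and the sigma-algebra at a stopping time\<close>

text \<open>
  On the event \<open>\<tau> \<le> t\<close> the stopped value is the composition of \<open>\<omega> \<mapsto> (\<tau> \<omega>, \<omega>)\<close>, which maps into
  \<open>{..t} \<times> \<Omega>\<close>, with the restriction of \<open>F\<close> that is measurable with respect to \<open>\<F> t\<close>.
\<close>

lemma measurable_stopped_value_pre_sigma:
  fixes \<F> :: "'t::extended_time \<Rightarrow> 'a measure" and F :: "'t \<Rightarrow> 'a \<Rightarrow> ereal"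
  assumes "filtration \<Omega> \<F>" and F: "progressively_measurable \<F> F" and \<tau>: "stopping_time \<F> \<tau>"
  shows "stopped_value F \<tau> \<in> borel_measurable (filtration.pre_sigma \<Omega> \<F> \<tau>)"
proof -
  interpret filtration \<Omega> \<F> by fact
  have loc: "(\<lambda>(s, \<omega>). F s \<omega>) \<in> borel_measurable (restrict_space borel {..t} \<Otimes>\<^sub>M \<F> t)" for t
  proof (cases "t = top")
    case True
    then have "{..t} = UNIV"
      by auto
    then have "sets (restrict_space borel {..t}) = sets borel"
      by (simp add: sets_restrict_space)
    then have "sets (restrict_space borel {..t} \<Otimes>\<^sub>M \<F> t) = sets (borel \<Otimes>\<^sub>M \<F> t)"
      by (rule sets_pair_measure_cong) (rule refl)
    then show ?thesis
      using F True by (simp add: progressively_measurable_def cong: measurable_cong_sets)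
  next
    case False
    then show ?thesis
      using F by (simp add: progressively_measurable_def less_top)
  qed
  have "{\<omega> \<in> {\<omega> \<in> \<Omega>. stopped_value F \<tau> \<omega> \<in> A}. \<tau> \<omega> \<le> t} \<in> sets (\<F> t)"
    if A[measurable]: "A \<in> sets borel" for A t
  proof -
    let ?S = "{\<omega> \<in> space (\<F> t). \<tau> \<omega> \<le> t}"
    let ?M = "restrict_space (\<F> t) ?S"
    have S: "?S \<in> sets (\<F> t)"
      using stopping_timeD[OF \<tau>] by simp
    have sp: "space ?M = ?S"
      by (auto simp: space_restrict_space)
    have "\<tau> \<in> ?M \<rightarrow>\<^sub>M borel"
    proof (rule borel_measurableI_le)
      fix s
      have "{\<omega> \<in> space (\<F> t). \<tau> \<omega> \<le> min s t} \<in> sets (\<F> t)"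
        using stopping_time_le_const[OF \<tau>, of "min s t" t] by (simp add: pred_def)
      also have "{\<omega> \<in> space (\<F> t). \<tau> \<omega> \<le> min s t} = {\<omega> \<in> space ?M. \<tau> \<omega> \<le> s}"
        by (auto simp: sp)
      finally show "{\<omega> \<in> space ?M. \<tau> \<omega> \<le> s} \<in> sets ?M"
        using S by (subst sets_restrict_space_iff) (auto simp: sp)
    qed
    then have "\<tau> \<in> ?M \<rightarrow>\<^sub>M restrict_space borel {..t}"
      by (intro measurable_restrict_space2) (auto simp: sp)
    moreover have "(\<lambda>\<omega>. \<omega>) \<in> ?M \<rightarrow>\<^sub>M \<F> t"
      by (intro measurable_restrict_space1) simp
    ultimately have "(\<lambda>\<omega>. (\<tau> \<omega>, \<omega>)) \<in> ?M \<rightarrow>\<^sub>M restrict_space borel {..t} \<Otimes>\<^sub>M \<F> t"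
      by (rule measurable_Pair)
    from measurable_compose[OF this loc]
    have "stopped_value F \<tau> \<in> borel_measurable ?M"
      by (simp add: stopped_value_def[abs_def])
    then have "stopped_value F \<tau> -` A \<inter> space ?M \<in> sets ?M"
      using A by (rule measurable_sets)
    then have "stopped_value F \<tau> -` A \<inter> ?S \<in> sets (\<F> t)"
      using S by (subst (asm) sets_restrict_space_iff) (auto simp: sp)
    also have "stopped_value F \<tau> -` A \<inter> ?S = {\<omega> \<in> {\<omega> \<in> \<Omega>. stopped_value F \<tau> \<omega> \<in> A}. \<tau> \<omega> \<le> t}"
      by (auto simp: space_F)
    finally show ?thesis .
  qed
  then show ?thesis
    by (intro measurableI) (auto simp: space_pre_sigma vimage_def Int_def conj_commute
        intro!: sets_pre_sigmaI[OF \<tau>])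
qed

lemma subalgebra_pre_sigma:
  assumes "filtration \<Omega> \<F>" and \<tau>: "stopping_time \<F> \<tau>" and P: "sets P = sets (\<F> (top :: 't::extended_time))"
  shows "subalgebra P (filtration.pre_sigma \<Omega> \<F> \<tau>)"
proof -
  interpret filtration \<Omega> \<F> by fact
  have "space P = \<Omega>"
    using sets_eq_imp_space_eq[OF P] by (simp add: space_F)
  moreover have "A \<in> sets P" if "A \<in> sets (pre_sigma \<tau>)" for A
    using sets_pre_sigmaD[OF \<tau> that, of top] by (simp add: P)
  ultimately show ?thesis
    by (auto simp: subalgebra_def space_pre_sigma)
qed

section \<open>Quasiconvexity of the objective functions\<close>

lemma ln_ennreal_le_iff: "ln_ennreal a \<le> ereal b \<longleftrightarrow> a \<le> ennreal (exp b)"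
proof (cases a)
  case (real r)
  show ?thesis
  proof (cases "r = 0")
    case False
    then have "0 < r" using real by simp
    then have "ln r \<le> b \<longleftrightarrow> r \<le> exp b"
      by (metis exp_le_cancel_iff exp_ln)
    then show ?thesis
      using real \<open>0 < r\<close> by (simp add: ln_ennreal_def)
  qed (use real in \<open>simp add: ln_ennreal_def\<close>)
qed (simp add: ln_ennreal_def top_unique)

text \<open>
  Testing real levels is enough: an extended real number is the infimum of the reals above it.
\<close>

lemma quasiconvex_onI:
  assumes "convex S"
    and "\<And>x y u v a. \<lbrakk>x \<in> S; y \<in> S; 0 \<le> u; 0 \<le> v; u + v = 1; f x \<le> ereal a; f y \<le> ereal a\<rbrakk>
           \<Longrightarrow> f (u *\<^sub>R x + v *\<^sub>R y) \<le> ereal a"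
  shows "quasiconvex_on S f"
  unfolding quasiconvex_on_def
proof (intro conjI ballI allI impI)
  fix x y u v assume *: "x \<in> S" "y \<in> S" "0 \<le> u" "0 \<le> v" "u + v = (1::real)"
  show "f (u *\<^sub>R x + v *\<^sub>R y) \<le> max (f x) (f y)"
    by (rule ereal_le_real) (use * assms(2) in auto)
qed fact

text \<open>
  Convexity of \<open>exp\<close> along the affine exponent. If \<open>y\<close> is infinite, then the sign of
  \<open>s * y\<close> decides about all three exponentials at once, because \<open>x1\<close>, \<open>x2\<close> and their convex
  combination are positive.
\<close>

lemma exp_ereal_convex_combination:
  fixes y :: ereal and x1 x2 u v s :: real
  assumes "0 < x1" "0 < x2" "0 \<le> u" "0 \<le> v" "u + v = 1" "s \<noteq> 0"
  shows "exp_ereal (ereal (s * (u * x1 + v * x2)) * y + ereal (u * g1 + v * g2))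
     \<le> ennreal u * exp_ereal (ereal (s * x1) * y + ereal g1)
        + ennreal v * exp_ereal (ereal (s * x2) * y + ereal g2)"
proof (cases y)
  case (real r)
  have "convex_on UNIV (exp :: real \<Rightarrow> real)"
    by (rule exp_convex)
  from convex_onD[OF this, of v "s * x1 * r + g1" "s * x2 * r + g2"]
  have "exp (u * (s * x1 * r + g1) + v * (s * x2 * r + g2))
      \<le> u * exp (s * x1 * r + g1) + v * exp (s * x2 * r + g2)"
    using assms by (simp add: eq_diff_eq[THEN iffD2, of u v 1])
  also have "u * (s * x1 * r + g1) + v * (s * x2 * r + g2)
      = s * (u * x1 + v * x2) * r + (u * g1 + v * g2)"
    by (simp add: algebra_simps)
  finally show ?thesis
    using real assms by (simp add: exp_ereal_def ennreal_mult[symmetric] flip: ennreal_plus)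
next
  case PInf
  have "0 < u * x1 + v * x2"
    using assms by (cases "u = 0") (auto intro: add_pos_nonneg)
  moreover have "0 < u \<or> 0 < v"
    using assms by linarith
  ultimately show ?thesis
    using PInf assms by (cases "0 < s") (auto simp: mult_neg_pos ennreal_mult_top zero_less_mult_iff mult_less_0_iff)
next
  case MInf
  have "0 < u * x1 + v * x2"
    using assms by (cases "u = 0") (auto intro: add_pos_nonneg)
  moreover have "0 < u \<or> 0 < v"
    using assms by linarith
  ultimately show ?thesis
    using MInf assms by (cases "0 < s") (auto simp: mult_neg_pos ennreal_mult_top zero_less_mult_iff mult_less_0_iff)
qed

lemma exp_ereal_add: "exp_ereal (y + ereal t) = ennreal (exp t) * exp_ereal y"
  by (cases y) (auto simp: exp_ereal_def exp_add ennreal_mult mult.commute ennreal_mult_top)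

text \<open>
  The level set \<open>{c. f c \<le> a}\<close> is \<open>{c. I c a \<le> 1}\<close>, where the integrand of \<open>I c a\<close> is a convex
  function of \<open>c\<close>.
\<close>

lemma quasiconvex_on_scaled_log_mgf:
  fixes Y :: "'a \<Rightarrow> ereal" and G :: "'a \<Rightarrow> real" and s :: real
  assumes [measurable]: "Y \<in> borel_measurable P" "G \<in> borel_measurable P"
    and R: "0 \<le> R" and s: "s \<noteq> 0"
  shows "quasiconvex_on {0<..} (\<lambda>c. ereal (1 / c) *
           ln_ennreal (\<integral>\<^sup>+ \<omega>. exp_ereal (ereal (s * c) * Y \<omega> + ereal (G \<omega>)) \<partial>P) + ereal (1 / c) * R)"
    (is "quasiconvex_on _ ?f")
proof (cases R)
  case (real r)
  define I where "I c a = (\<integral>\<^sup>+ \<omega>. exp_ereal (ereal (s * c) * Y \<omega> + ereal (G \<omega> + (r - a * c))) \<partial>P)" for c a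
  have level: "?f c \<le> ereal a \<longleftrightarrow> I c a \<le> 1" if "0 < c" for c a
  proof -
    let ?Z = "\<integral>\<^sup>+ \<omega>. exp_ereal (ereal (s * c) * Y \<omega> + ereal (G \<omega>)) \<partial>P"
    have "I c a = (\<integral>\<^sup>+ \<omega>. ennreal (exp (r - a * c)) * exp_ereal (ereal (s * c) * Y \<omega> + ereal (G \<omega>)) \<partial>P)"
      unfolding I_def
      by (intro nn_integral_cong) (simp flip: exp_ereal_add plus_ereal.simps(1) add.assoc)
    also have "\<dots> = ennreal (exp (r - a * c)) * ?Z"
      by (rule nn_integral_cmult) measurable
    finally have I: "I c a = ennreal (exp (r - a * c)) * ?Z" .
    have "?f c \<le> ereal a \<longleftrightarrow> ln_ennreal ?Z \<le> ereal (a * c - r)"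
      using that real by (cases "ln_ennreal ?Z") (auto simp: field_simps)
    also have "\<dots> \<longleftrightarrow> ?Z \<le> ennreal (exp (a * c - r))"
      by (rule ln_ennreal_le_iff)
    also have "\<dots> \<longleftrightarrow> I c a \<le> 1"
    proof (cases ?Z)
      case (real z)
      then show ?thesis
        unfolding I by (simp add: exp_diff field_simps flip: ennreal_mult)
    qed (simp add: I ennreal_mult_top top_unique)
    finally show ?thesis .
  qed
  show ?thesis
  proof (rule quasiconvex_onI)
    fix x y u v a :: real
    assume x: "x \<in> {0<..}" and y: "y \<in> {0<..}" and uv: "0 \<le> u" "0 \<le> v" "u + v = 1"
      and "?f x \<le> ereal a" "?f y \<le> ereal a"
    then have I: "I x a \<le> 1" "I y a \<le> 1"
      using level by auto
    have pos: "0 < u * x + v * y"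
      using x y uv by (cases "u = 0") (auto intro: add_pos_nonneg)
    have "I (u * x + v * y) a \<le>
        (\<integral>\<^sup>+ \<omega>. ennreal u * exp_ereal (ereal (s * x) * Y \<omega> + ereal (G \<omega> + (r - a * x)))
             + ennreal v * exp_ereal (ereal (s * y) * Y \<omega> + ereal (G \<omega> + (r - a * y))) \<partial>P)"
      unfolding I_def
    proof (rule nn_integral_mono)
      fix \<omega>
      have "G \<omega> + (r - a * (u * x + v * y))
          = (u + v) * (G \<omega> + r) - a * (u * x + v * y)"
        using uv by simp
      also have "\<dots> = u * (G \<omega> + (r - a * x)) + v * (G \<omega> + (r - a * y))"
        by (simp add: algebra_simps)
      finally show "exp_ereal (ereal (s * (u * x + v * y)) * Y \<omega> + ereal (G \<omega> + (r - a * (u * x + v * y))))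
          \<le> ennreal u * exp_ereal (ereal (s * x) * Y \<omega> + ereal (G \<omega> + (r - a * x)))
             + ennreal v * exp_ereal (ereal (s * y) * Y \<omega> + ereal (G \<omega> + (r - a * y)))"
        using exp_ereal_convex_combination[of x y u v s] x y uv s by simp
    qed
    also have "\<dots> = ennreal u * I x a + ennreal v * I y a"
      unfolding I_def by (subst nn_integral_add) (auto simp: nn_integral_cmult)
    also have "\<dots> \<le> ennreal u * 1 + ennreal v * 1"
      using I by (intro add_mono mult_left_mono) auto
    also have "\<dots> = 1"
      using uv by (simp flip: ennreal_plus)
    finally show "?f (u *\<^sub>R x + v *\<^sub>R y) \<le> ereal a"
      using level[OF pos, of a] by simp
  qed (rule convex_real_interval)
next
  case PInf
  then show ?thesis
    by (intro quasiconvex_onI convex_real_interval) auto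
qed (use R in auto)

section \<open>The bounds\<close>

lemma ereal_integrable_affine:
  assumes f: "ereal_integrable M f" and g: "integrable M g"
  shows "ereal_integrable M (\<lambda>x. ereal c * f x + ereal (g x))"
    and "ereal_integral M (\<lambda>x. ereal c * f x + ereal (g x))
      = ereal c * ereal_integral M f + ereal (\<integral>x. g x \<partial>M)"
proof -
  have [measurable]: "f \<in> borel_measurable M" "g \<in> borel_measurable M"
    using f g by (auto simp: ereal_integrable_def)
  obtain k where k: "integrable M k" "AE x in M. f x = ereal (k x)"
    using f by (auto simp: ereal_integrable_iff_real)
  have int: "integrable M (\<lambda>x. c * k x + g x)"
    using k g by auto
  have AE: "AE x in M. ereal c * f x + ereal (g x) = ereal (c * k x + g x)"
    using k(2) by eventually_elim simp
  from int AE show "ereal_integrable M (\<lambda>x. ereal c * f x + ereal (g x))"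
    unfolding ereal_integrable_iff_real by (auto intro!: exI[of _ "\<lambda>x. c * k x + g x"])
  show "ereal_integral M (\<lambda>x. ereal c * f x + ereal (g x))
      = ereal c * ereal_integral M f + ereal (\<integral>x. g x \<partial>M)"
    using k g by (simp add: ereal_integral_eq_integral[OF int AE] ereal_integral_eq_integral[OF k])
qed

text \<open>
  The Gibbs inequality for \<open>s c Y + G\<close>, divided by \<open>c\<close>. The case \<open>G = 0\<close> on the space of values of
  \<open>Y\<close> gives the first bound of the theorem; the general case keeps \<open>G\<close> on the left, where its
  expectation later cancels the relative entropy.
\<close>

lemma ereal_integral_le_scaled_log_mgf:
  fixes G :: "'a \<Rightarrow> real"
  assumes PQ: "prob_space P" "prob_space Q" "sets Q = sets P"
    and Y: "ereal_integrable Q Y" and G: "integrable Q G" and c: "0 < c"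
  shows "ereal s * ereal_integral Q Y + ereal (1 / c) * ereal (\<integral>x. G x \<partial>Q)
    \<le> ereal (1 / c) * ln_ennreal (\<integral>\<^sup>+ x. exp_ereal (ereal (s * c) * Y x + ereal (G x)) \<partial>P)
       + ereal (1 / c) * relative_entropy Q P"
proof -
  let ?A = "ln_ennreal (\<integral>\<^sup>+ x. exp_ereal (ereal (s * c) * Y x + ereal (G x)) \<partial>P)"
  obtain k where "integrable Q k" "AE x in Q. Y x = ereal (k x)"
    using Y by (auto simp: ereal_integrable_iff_real)
  then obtain e where e: "ereal_integral Q Y = ereal e"
    using ereal_integral_eq_integral by blast
  have bound: "ereal (s * c * e + (\<integral>x. G x \<partial>Q)) \<le> ?A + relative_entropy Q P"
    using gibbs_variational_inequality[OF PQ ereal_integrable_affine(1)[OF Y G]]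
    by (simp add: ereal_integrable_affine(2)[OF Y G] e)
  have "ereal s * ereal_integral Q Y + ereal (1 / c) * ereal (\<integral>x. G x \<partial>Q)
      = ereal (1 / c) * ereal (s * c * e + (\<integral>x. G x \<partial>Q))"
    using c by (simp add: e field_simps)
  also have "\<dots> \<le> ereal (1 / c) * (?A + relative_entropy Q P)"
    using bound c by (intro ereal_mult_left_mono) auto
  also have "\<dots> = ereal (1 / c) * ?A + ereal (1 / c) * relative_entropy Q P"
    using c by (cases ?A; cases "relative_entropy Q P") (auto simp: add_divide_distrib)
  finally show ?thesis .
qed

theorem corollary3:
  fixes \<Omega> :: "'a set" and \<F> :: "'t::extended_time \<Rightarrow> 'a measure"
    and P P' :: "'a measure" and F :: "'t \<Rightarrow> 'a \<Rightarrow> ereal" and \<tau> :: "'a \<Rightarrow> 't"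
  assumes "filtration \<Omega> \<F>"
    and "prob_space P" and "sets P = sets (\<F> top)"
    and "prob_space P'" and "sets P' = sets (\<F> top)"
    and "progressively_measurable \<F> F"
    and "stopping_time \<F> \<tau>"
    and "ereal_integrable P' (stopped_value F \<tau>)"
  shows "let Y = stopped_value F \<tau>;
             \<F>\<tau> = filtration.pre_sigma \<Omega> \<F> \<tau>;
             R\<^sub>1 = relative_entropy (distr P' borel Y) (distr P borel Y);
             R\<^sub>2 = relative_entropy (restr_to_subalg P' \<F>\<tau>) (restr_to_subalg P \<F>\<tau>)
         in \<forall>s\<in>{1, -1 :: real}.
              ereal s * ereal_integral P' Y
                \<le> (INF c\<in>{0<..}. ereal (1 / c) * cumulant_gen P Y (s * c) + ereal (1 / c) * R\<^sub>1) \<and>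
              (INF c\<in>{0<..}. ereal (1 / c) * cumulant_gen P Y (s * c) + ereal (1 / c) * R\<^sub>1)
                \<le> (INF c\<in>{0<..}. ereal (1 / c) * cumulant_gen P Y (s * c) + ereal (1 / c) * R\<^sub>2) \<and>
              quasiconvex_on {0<..}
                (\<lambda>c. ereal (1 / c) * cumulant_gen P Y (s * c) + ereal (1 / c) * R\<^sub>1) \<and>
              quasiconvex_on {0<..}
                (\<lambda>c. ereal (1 / c) * cumulant_gen P Y (s * c) + ereal (1 / c) * R\<^sub>2) \<and>
              (\<forall>G :: 'a \<Rightarrow> real.
                 G \<in> borel_measurable \<F>\<tau> \<longrightarrow> integrable P' G \<longrightarrow>
                 R\<^sub>2 \<le> ereal (\<integral>\<omega>. G \<omega> \<partial>P') \<longrightarrow>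
                   ereal s * ereal_integral P' Y
                     \<le> (INF c\<in>{0<..}. ereal (1 / c) *
                          ln_ennreal (\<integral>\<^sup>+ \<omega>. exp_ereal (ereal (s * c) * Y \<omega> + ereal (G \<omega>)) \<partial>P)) \<and>
                   quasiconvex_on {0<..} (\<lambda>c. ereal (1 / c) *
                     ln_ennreal (\<integral>\<^sup>+ \<omega>. exp_ereal (ereal (s * c) * Y \<omega> + ereal (G \<omega>)) \<partial>P)))"
proof -
  let ?Y = "stopped_value F \<tau>" and ?G = "filtration.pre_sigma \<Omega> \<F> \<tau>"
  let ?P1 = "distr P borel ?Y" and ?Q1 = "distr P' borel ?Y"
  let ?P2 = "restr_to_subalg P ?G" and ?Q2 = "restr_to_subalg P' ?G"
  have subalg: "subalgebra P ?G" "subalgebra P' ?G"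
    using assms by (auto intro: subalgebra_pre_sigma)
  have Y: "?Y \<in> borel_measurable ?G"
    using assms by (intro measurable_stopped_value_pre_sigma)
  have Y_P[measurable]: "?Y \<in> borel_measurable P" "?Y \<in> borel_measurable P'"
    using measurable_from_subalg[OF subalg(1) Y] measurable_from_subalg[OF subalg(2) Y] .
  have prob1: "prob_space ?P1" "prob_space ?Q1"
    using assms Y_P by (auto intro: prob_space.prob_space_distr)
  have prob2: "prob_space ?P2" "prob_space ?Q2" "sets ?Q2 = sets ?P2"
    using assms subalg by (auto intro: prob_space_restr_to_subalg simp: sets_restr_to_subalg)
  let ?R1 = "relative_entropy ?Q1 ?P1" and ?R2 = "relative_entropy ?Q2 ?P2"
  have R_nonneg: "0 \<le> ?R1" "0 \<le> ?R2"
    using prob1 prob2 by (auto intro: relative_entropy_nonneg)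
  have distr: "distr (restr_to_subalg M ?G) borel ?Y = distr M borel ?Y"
    if "subalgebra M ?G" for M :: "'a measure"
  proof (rule measure_eqI)
    fix A assume "A \<in> sets (distr (restr_to_subalg M ?G) borel ?Y)"
    then have A: "A \<in> sets borel" by simp
    have sp: "space ?G = space M"
      using that by (simp add: subalgebra_def)
    have "?Y -` A \<inter> space M \<in> sets ?G"
      using measurable_sets[OF Y A] by (simp add: sp)
    then show "emeasure (distr (restr_to_subalg M ?G) borel ?Y) A = emeasure (distr M borel ?Y) A"
      using A that Y by (simp add: emeasure_distr measurable_in_subalg measurable_from_subalg
          space_restr_to_subalg emeasure_restr_to_subalg)
  qed simp
  \<comment> \<open>The laws of \<open>F\<^sub>\<tau>\<close> are the same under the restricted measures, so data processing compares
    them with the restrictions to the sigma-algebra at time \<open>\<tau>\<close>.\<close>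
  have R_le: "?R1 \<le> ?R2"
    using relative_entropy_distr_le[OF prob2 measurable_in_subalg[OF subalg(1) Y]]
    by (simp add: distr subalg)
  have quasi: "quasiconvex_on {0<..} (\<lambda>c. ereal (1 / c) * cumulant_gen P ?Y (s * c) + ereal (1 / c) * R)"
    if "s \<noteq> 0" "0 \<le> R" for s R
    using quasiconvex_on_scaled_log_mgf[of ?Y P "\<lambda>_. 0" R s] that
    by (simp add: cumulant_gen_def zero_ereal_def[symmetric])
  have bound1: "ereal s * ereal_integral P' ?Y
      \<le> ereal (1 / c) * cumulant_gen P ?Y (s * c) + ereal (1 / c) * ?R1" if "0 < c" for s c
  proof -
    have E: "ereal_integral ?Q1 (\<lambda>y. y) = ereal_integral P' ?Y"
      by (simp add: ereal_integral_def nn_integral_distr)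
    have "ereal_integrable ?Q1 (\<lambda>y. y)"
      using assms(8) by (simp add: ereal_integrable_def nn_integral_distr)
    from ereal_integral_le_scaled_log_mgf[OF prob1 _ this, of "\<lambda>_. 0" c s] that
    show ?thesis
      by (simp add: E cumulant_gen_def nn_integral_distr zero_ereal_def[symmetric])
  qed
  have bound2: "ereal s * ereal_integral P' ?Y
      \<le> ereal (1 / c) * ln_ennreal (\<integral>\<^sup>+ \<omega>. exp_ereal (ereal (s * c) * ?Y \<omega> + ereal (G \<omega>)) \<partial>P)"
    if c: "0 < c" and G[measurable]: "G \<in> borel_measurable ?G" and int: "integrable P' G"
      and le: "?R2 \<le> ereal (\<integral>\<omega>. G \<omega> \<partial>P')" for s c G
  proof -
    note [measurable] = Y
    let ?A = "ln_ennreal (\<integral>\<^sup>+ \<omega>. exp_ereal (ereal (s * c) * ?Y \<omega> + ereal (G \<omega>)) \<partial>P)"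
    have E: "ereal_integral ?Q2 ?Y = ereal_integral P' ?Y"
      by (simp add: ereal_integral_def nn_integral_subalgebra2[OF subalg(2)])
    have "ereal_integrable ?Q2 ?Y"
      using assms(8) Y
      by (simp add: ereal_integrable_def nn_integral_subalgebra2[OF subalg(2)]
          measurable_in_subalg[OF subalg(2)])
    from ereal_integral_le_scaled_log_mgf[OF prob2 this integrable_in_subalg[OF subalg(2) G int] c, of s]
    have *: "ereal s * ereal_integral P' ?Y + ereal (1 / c) * ereal (\<integral>\<omega>. G \<omega> \<partial>P')
        \<le> ereal (1 / c) * ?A + ereal (1 / c) * ?R2"
      by (simp add: E nn_integral_subalgebra2[OF subalg(1)] integral_subalgebra2[OF subalg(2)])
    have "ereal (1 / c) * ?R2 \<le> ereal (1 / c) * ereal (\<integral>\<omega>. G \<omega> \<partial>P')"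
      using le c by (intro ereal_mult_left_mono) auto
    \<comment> \<open>The same finite number is now added on both sides and can be cancelled.\<close>
    then have "ereal s * ereal_integral P' ?Y + ereal (1 / c * (\<integral>\<omega>. G \<omega> \<partial>P'))
        \<le> ereal (1 / c) * ?A + ereal (1 / c * (\<integral>\<omega>. G \<omega> \<partial>P'))"
      using order_trans[OF * add_left_mono] by simp
    then show ?thesis
      by (simp add: ereal_add_le_add_iff2)
  qed
  have quasi2: "quasiconvex_on {0<..} (\<lambda>c. ereal (1 / c) *
      ln_ennreal (\<integral>\<^sup>+ \<omega>. exp_ereal (ereal (s * c) * ?Y \<omega> + ereal (G \<omega>)) \<partial>P))"
    if "s \<noteq> 0" "G \<in> borel_measurable ?G" for s G
    using quasiconvex_on_scaled_log_mgf[OF Y_P(1) measurable_from_subalg[OF subalg(1) that(2)],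
        of 0 s] that by simp
  show ?thesis
    unfolding Let_def
  proof (intro ballI conjI allI impI)
    fix s :: real assume "s \<in> {1, -1}"
    then have s: "s \<noteq> 0" by auto
    show "ereal s * ereal_integral P' ?Y
        \<le> (INF c\<in>{0<..}. ereal (1 / c) * cumulant_gen P ?Y (s * c) + ereal (1 / c) * ?R1)"
      by (intro INF_greatest bound1) simp
    show "(INF c\<in>{0<..}. ereal (1 / c) * cumulant_gen P ?Y (s * c) + ereal (1 / c) * ?R1)
        \<le> (INF c\<in>{0<..}. ereal (1 / c) * cumulant_gen P ?Y (s * c) + ereal (1 / c) * ?R2)"
      using R_le by (intro INF_mono) (auto intro!: add_left_mono ereal_mult_left_mono bexI)
    show "quasiconvex_on {0<..} (\<lambda>c. ereal (1 / c) * cumulant_gen P ?Y (s * c) + ereal (1 / c) * ?R1)"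
      "quasiconvex_on {0<..} (\<lambda>c. ereal (1 / c) * cumulant_gen P ?Y (s * c) + ereal (1 / c) * ?R2)"
      using s R_nonneg by (auto intro: quasi)
    fix G assume G: "G \<in> borel_measurable ?G" "integrable P' G" "?R2 \<le> ereal (\<integral>\<omega>. G \<omega> \<partial>P')"
    then show "ereal s * ereal_integral P' ?Y
        \<le> (INF c\<in>{0<..}. ereal (1 / c) *
            ln_ennreal (\<integral>\<^sup>+ \<omega>. exp_ereal (ereal (s * c) * ?Y \<omega> + ereal (G \<omega>)) \<partial>P))"
      by (intro INF_greatest bound2) auto
    show "quasiconvex_on {0<..} (\<lambda>c. ereal (1 / c) *
        ln_ennreal (\<integral>\<^sup>+ \<omega>. exp_ereal (ereal (s * c) * ?Y \<omega> + ereal (G \<omega>)) \<partial>P))"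
      using s G by (intro quasi2)
  qed
qed

end
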